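(* Let $q$ be a positive even integer and $t\geq1$ an integer. If $G$ is a graph on $q^2+q+1$ vertices with $\frac12 q(q+1)^2+t$ edges, then $G$ contains at least $\frac12(tq-2.5q-t)$ copies of $C_4$.
   Context: Copies of $C_4$ are distinct subgraphs isomorphic to the $4$-cycle. *)

theory Defs
  imports Complex_Main
begin

type_synonym 'a graph = "'a set \<times> 'a set set"

abbreviation verts :: "'a graph \<Rightarrow> 'a set" where
  "verts G \<equiv> fst G"

abbreviation edges :: "'a graph \<Rightarrow> 'a set set" where
  "edges G \<equiv> snd G"

definition simple_graph :: "'a graph \<Rightarrow> bool" where
  "simple_graph G \<longleftrightarrow> (\<forall>e \<in> edges G. e \<subseteq> verts G \<and> card e = 2)"

definition subgraph :: "'a graph \<Rightarrow> 'a graph \<Rightarrow> bool" where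
  "subgraph K G \<longleftrightarrow> simple_graph K \<and> verts K \<subseteq> verts G \<and> edges K \<subseteq> edges G"

definition graph_iso :: "'a graph \<Rightarrow> 'b graph \<Rightarrow> bool" where
  "graph_iso G H \<longleftrightarrow>
     (\<exists>f. bij_betw f (verts G) (verts H) \<and>
          (\<forall>u \<in> verts G. \<forall>v \<in> verts G. {u, v} \<in> edges G \<longleftrightarrow> {f u, f v} \<in> edges H))"

text \<open>Meant for \<open>n \<ge> 3\<close>: there is a loop for \<open>n = 1\<close>, and only one edge for \<open>n = 2\<close>.\<close>

definition cycle_graph :: "nat \<Rightarrow> nat graph" where
  "cycle_graph n = ({..<n}, {{i, (i + 1) mod n} | i. i < n})"

text \<open>A copy is a subgraph, not an embedding, so the automorphisms of \<open>H\<close> do not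
  multiply the count.\<close>

definition copies :: "'b graph \<Rightarrow> 'a graph \<Rightarrow> 'a graph set" where
  "copies H G = {K. subgraph K G \<and> graph_iso K H}"

end

theory Submission
  imports Defs
begin

text \<open>Write \<open>a v = deg v - (q + 1)\<close> and let \<open>T = 8 #C\<^sub>4\<close> be the sum of
  \<open>codeg u v * (codeg u v - 1)\<close> over ordered pairs of distinct vertices. Suppose \<open>T\<close> is smaller than
  claimed. If \<open>a x \<ge> 1\<close>, then double counting the pairs of vertices outside the neighbourhood of \<open>x\<close>
  shows that \<open>x\<close> lies on at least \<open>(t + 1) * a x\<close> 4-cycles, so the positive part of \<open>a\<close> has sum
  \<open>P < 2 * q\<close>. On the other hand, a vertex of degree \<open>q + 1\<close> without neighbours of degree at most
  \<open>q\<close> lies on a 4-cycle, because \<open>q + 1\<close> is odd (as in Fueredi's theorem). The vertices of degree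
  at most \<open>q\<close> dominate only few others, and summing over all vertices yields
  \<open>T \<ge> 2 * (2 * t * (q + 1) - q - 2 * P)\<close>, a contradiction.\<close>

section \<open>Counting pairs and incidences\<close>

lemma sum_card_remove1:
  assumes "finite B"
  shows "(\<Sum>u\<in>B. int (card (B - {u}))) = int (card B) * (int (card B) - 1)"
proof -
  have "int (card (B - {u})) = int (card B) - 1" if "u \<in> B" for u
    using card_Suc_Diff1[OF assms that] by linarith
  then show ?thesis by simp
qed

lemma prod_pred_nonneg: "0 \<le> c * (c - 1)" for c :: int
  by (cases "c \<ge> 1") (auto intro: mult_nonneg_nonneg mult_nonpos_nonpos)

text \<open>The difference of the sides is \<open>(c - 1) * (c - 2)\<close>, a product of
  consecutive integers, so nothing is lost at codegrees 1 and 2. This bounds \<open>quads\<close>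
  below by the linear \<open>codeg_excess\<close>.\<close>

lemma twice_pred_le: "2 * (c - 1) \<le> c * (c - 1)" for c :: int
  using prod_pred_nonneg[of "c - 1"] by (simp add: algebra_simps)

text \<open>Double counting of incidences, for an arbitrary graph because the parity argument
  applies it to the graph induced on a neighbourhood.\<close>

lemma handshake:
  assumes "simple_graph G" "finite (verts G)"
  shows "(\<Sum>v\<in>verts G. card {u. {u, v} \<in> edges G}) = 2 * card (edges G)"
proof -
  have fin: "finite (edges G)"
    using assms by (intro finite_subset[of "edges G" "Pow (verts G)"]) (auto simp: simple_graph_def)
  have "card {u. {u, v} \<in> edges G} = (\<Sum>e\<in>edges G. if v \<in> e then 1 else 0)" for v
  proof -
    have "bij_betw (\<lambda>u. {u, v}) {u. {u, v} \<in> edges G} {e \<in> edges G. v \<in> e}"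
      unfolding bij_betw_def
    proof
      show "inj_on (\<lambda>u. {u, v}) {u. {u, v} \<in> edges G}"
        by (auto simp: inj_on_def doubleton_eq_iff)
      show "(\<lambda>u. {u, v}) ` {u. {u, v} \<in> edges G} = {e \<in> edges G. v \<in> e}"
      proof (intro equalityI subsetI)
        fix e assume e: "e \<in> {e \<in> edges G. v \<in> e}"
        then have "card e = 2"
          using assms by (auto simp: simple_graph_def)
        then obtain x y where "e = {x, y}"
          by (auto simp: card_2_iff)
        with e show "e \<in> (\<lambda>u. {u, v}) ` {u. {u, v} \<in> edges G}"
          by (auto simp: insert_commute)
      qed auto
    qed
    then show ?thesis
      using fin by (simp add: bij_betw_same_card sum.If_cases Int_def conj_commute)
  qed
  then have "(\<Sum>v\<in>verts G. card {u. {u, v} \<in> edges G})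
      = (\<Sum>e\<in>edges G. \<Sum>v\<in>verts G. if v \<in> e then 1 else 0)"
    by (simp add: sum.swap[of _ "edges G"])
  also have "\<dots> = (\<Sum>e\<in>edges G. 2)"
  proof (rule sum.cong)
    fix e assume "e \<in> edges G"
    then have "e \<subseteq> verts G" "card e = 2"
      using assms by (auto simp: simple_graph_def)
    moreover from this have "verts G \<inter> e = e" by auto
    ultimately show "(\<Sum>v\<in>verts G. if v \<in> e then 1 else 0) = (2::nat)"
      using assms by (simp add: sum.If_cases Int_def)
  qed simp
  finally show ?thesis by simp
qed

section \<open>Labelled 4-cycles and their symmetries\<close>

text \<open>The arguments follow the cyclic order, so the diagonals are \<open>v\<close>,
  \<open>x\<close> and \<open>a\<close>, \<open>b\<close>.\<close>

definition four_cycle :: "'a \<Rightarrow> 'a \<Rightarrow> 'a \<Rightarrow> 'a \<Rightarrow> 'a graph" where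
  "four_cycle v a x b = ({v, a, x, b}, {{v, a}, {a, x}, {x, b}, {b, v}})"

lemma cycle_graph_4: "cycle_graph 4 = ({0, 1, 2, 3}, {{0, 1}, {1, 2}, {2, 3}, {3, 0}})"
proof -
  have "{..<4::nat} = {0, 1, 2, 3}" by auto
  moreover have "{{i, (i + 1) mod 4} | i. i < (4::nat)} = (\<lambda>i. {i, (i + 1) mod 4}) ` {..<4}"
    by auto
  moreover have "(1 + 1) mod 4 = (2::nat)" "(2 + 1) mod 4 = (3::nat)" "(3 + 1) mod 4 = (0::nat)"
    by simp_all
  ultimately show ?thesis
    by (simp only: cycle_graph_def image_insert image_empty) simp
qed

lemma four_cycle_iso:
  assumes "distinct [v, a, x, b]"
  shows "graph_iso (four_cycle v a x b) (cycle_graph 4)"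
proof -
  have ne: "v \<noteq> a" "v \<noteq> x" "v \<noteq> b" "a \<noteq> x" "a \<noteq> b" "x \<noteq> b"
    using assms by auto
  define f :: "'a \<Rightarrow> nat" where "f = (\<lambda>_. 0)(a := 1, x := 2, b := 3)"
  have f: "f v = 0" "f a = 1" "f x = 2" "f b = 3"
    using assms by (auto simp: f_def)
  have "bij_betw f {v, a, x, b} {0, 1, 2, 3}"
    using f by (auto simp: bij_betw_def inj_on_def)
  moreover have "\<forall>u\<in>{v, a, x, b}. \<forall>w\<in>{v, a, x, b}.
      {u, w} \<in> {{v, a}, {a, x}, {x, b}, {b, v}} \<longleftrightarrow> {f u, f w} \<in> {{0, 1}, {1, 2}, {2, 3}, {3, 0}}"
    using ne ne[symmetric] by (simp add: f doubleton_eq_iff)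
  ultimately show ?thesis
    unfolding graph_iso_def cycle_graph_4 four_cycle_def fst_conv snd_conv by (intro exI[of _ f] conjI)
qed

text \<open>These are the eight dihedral symmetries, with the tuples listing one diagonal before the
  other. Three consecutive new edges lying among the old ones, together with distinctness, leave
  only these cases.\<close>

lemma four_cycle_eq_cases:
  assumes "distinct [v, a, x, b]" "distinct [v', a', x', b']"
    and "four_cycle v' a' x' b' = four_cycle v a x b"
  shows "(v', x', a', b') \<in> set [(v, x, a, b), (v, x, b, a), (x, v, a, b), (x, v, b, a),
    (a, b, v, x), (a, b, x, v), (b, a, v, x), (b, a, x, v)]"
proof -
  have E: "{{v', a'}, {a', x'}, {x', b'}, {b', v'}} = {{v, a}, {a, x}, {x, b}, {b, v}}"
    using assms(3) by (simp add: four_cycle_def)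
  have "{v', a'} \<in> {{v, a}, {a, x}, {x, b}, {b, v}}" "{a', x'} \<in> {{v, a}, {a, x}, {x, b}, {b, v}}"
    "{x', b'} \<in> {{v, a}, {a, x}, {x, b}, {b, v}}"
    by (simp_all flip: E)
  then show ?thesis
    using assms(1,2) by (simp add: doubleton_eq_iff) (elim disjE; simp)
qed

section \<open>Degrees, codegrees and their excess\<close>

locale finite_graph =
  fixes G :: "'a graph"
  assumes simple: "simple_graph G" and finite_verts: "finite (verts G)"
begin

definition nbrs :: "'a \<Rightarrow> 'a set" where
  "nbrs v = {u. {u, v} \<in> edges G}"

definition deg :: "'a \<Rightarrow> int" where
  "deg v = int (card (nbrs v))"

definition codeg :: "'a \<Rightarrow> 'a \<Rightarrow> int" where
  "codeg u v = int (card (nbrs u \<inter> nbrs v))"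

text \<open>It vanishes if \<open>v\<close> has exactly one common neighbour with each other vertex.
  Being linear in the codegrees, it is determined by degrees alone.\<close>

definition codeg_excess :: "'a \<Rightarrow> int" where
  "codeg_excess v = (\<Sum>x\<in>verts G - {v}. codeg v x - 1)"

text \<open>Twice the number of 4-cycles through \<open>v\<close>.\<close>

definition quads :: "'a \<Rightarrow> int" where
  "quads v = (\<Sum>x\<in>verts G - {v}. codeg v x * (codeg v x - 1))"

lemma nbrs_subset: "nbrs v \<subseteq> verts G"
  using simple by (auto simp: nbrs_def simple_graph_def)

lemma finite_nbrs [simp]: "finite (nbrs v)"
  using nbrs_subset finite_verts finite_subset by blast

lemma nbrs_sym: "u \<in> nbrs v \<longleftrightarrow> v \<in> nbrs u"
  by (simp add: nbrs_def insert_commute)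

lemma not_nbrs_self: "v \<notin> nbrs v"
  using simple by (force simp: nbrs_def simple_graph_def)

lemma sum_deg: "(\<Sum>v\<in>verts G. deg v) = 2 * int (card (edges G))"
  using handshake[OF simple finite_verts]
  by (simp add: deg_def nbrs_def flip: of_nat_sum)

lemma sum_nbrs: "(\<Sum>w\<in>nbrs v. g w) = (\<Sum>w\<in>verts G. if w \<in> nbrs v then g w else (0::int))"
  using nbrs_subset[of v] finite_verts by (simp add: sum.If_cases Int_absorb1)

lemma sum_sum_nbrs: "(\<Sum>v\<in>verts G. \<Sum>w\<in>nbrs v. g w) = (\<Sum>w\<in>verts G. deg w * g w)"
proof -
  have "(\<Sum>v\<in>verts G. \<Sum>w\<in>nbrs v. g w)
      = (\<Sum>w\<in>verts G. \<Sum>v\<in>verts G. if v \<in> nbrs w then g w else 0)"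
    unfolding sum_nbrs by (subst sum.swap) (simp add: nbrs_sym)
  also have "\<dots> = (\<Sum>w\<in>verts G. deg w * g w)"
    by (simp add: deg_def flip: sum_nbrs)
  finally show ?thesis .
qed

lemma codeg_eq_sum: "codeg u v = (\<Sum>w\<in>verts G. if w \<in> nbrs u \<and> w \<in> nbrs v then 1 else 0)"
proof -
  have "{w \<in> verts G. w \<in> nbrs u \<and> w \<in> nbrs v} = nbrs u \<inter> nbrs v"
    using nbrs_subset by blast
  then show ?thesis
    using finite_verts by (simp add: codeg_def sum.If_cases Int_def)
qed

lemma codeg_self: "codeg v v = deg v"
  by (simp add: codeg_def deg_def)

text \<open>Both sides count walks of length two from \<open>v\<close>; the term
  \<open>x = v\<close> accounts for those that return.\<close>

lemma sum_codeg: "(\<Sum>x\<in>verts G. codeg v x) = (\<Sum>w\<in>nbrs v. deg w)"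
proof -
  have "(\<Sum>x\<in>verts G. codeg v x)
      = (\<Sum>w\<in>verts G. \<Sum>x\<in>verts G. if w \<in> nbrs v \<and> w \<in> nbrs x then 1 else 0)"
    unfolding codeg_eq_sum by (rule sum.swap)
  also have "\<dots> = (\<Sum>w\<in>verts G. if w \<in> nbrs v then \<Sum>x\<in>nbrs w. 1 else 0)"
    unfolding sum_nbrs by (intro sum.cong) (auto simp: nbrs_sym)
  also have "\<dots> = (\<Sum>w\<in>nbrs v. deg w)"
    unfolding sum_nbrs[where v = v] by (simp add: deg_def cong: if_cong)
  finally show ?thesis .
qed

lemma codeg_excess_eq:
  assumes "v \<in> verts G"
  shows "codeg_excess v = (\<Sum>w\<in>nbrs v. deg w) - deg v - (int (card (verts G)) - 1)"
proof -
  have "card (verts G) \<ge> 1"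
    using assms finite_verts by (auto simp: Suc_le_eq card_gt_0_iff)
  then show ?thesis
    using assms finite_verts
    by (simp add: codeg_excess_def sum_subtractf sum_diff1 sum_codeg codeg_self)
qed

section \<open>Lower bounds for \<open>quads\<close> by double counting\<close>

lemma quads_nonneg: "0 \<le> quads v"
  unfolding quads_def by (intro sum_nonneg prod_pred_nonneg)

lemma quads_ge_excess: "2 * codeg_excess v \<le> quads v"
  unfolding quads_def codeg_excess_def sum_distrib_left by (intro sum_mono twice_pred_le)

text \<open>Both sides count the triples of a vertex \<open>y\<close> and an ordered pair of
  distinct neighbours of \<open>y\<close> in \<open>A\<close>.\<close>

lemma sum_pairs_codeg:
  assumes "A \<subseteq> verts G"
  shows "(\<Sum>y\<in>verts G. int (card (nbrs y \<inter> A)) * (int (card (nbrs y \<inter> A)) - 1))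
    = (\<Sum>u\<in>A. \<Sum>w\<in>A - {u}. codeg u w)"
proof -
  have fin: "finite A"
    using assms finite_verts finite_subset by blast
  have *: "int (card B) * (int (card B) - 1)
      = (\<Sum>u\<in>A. \<Sum>w\<in>A - {u}. if u \<in> B \<and> w \<in> B then 1 else 0)" if "B \<subseteq> A" for B
  proof -
    have fB: "finite B" using that fin finite_subset by blast
    have "(\<Sum>u\<in>A. \<Sum>w\<in>A - {u}. if u \<in> B \<and> w \<in> B then 1 else (0::int))
        = (\<Sum>u\<in>A. if u \<in> B then int (card (B - {u})) else 0)"
    proof (rule sum.cong)
      fix u assume "u \<in> A"
      have "{w \<in> A. w \<noteq> u \<and> w \<in> B} = B - {u}" using that by auto
      then show "(\<Sum>w\<in>A - {u}. if u \<in> B \<and> w \<in> B then 1 else (0::int))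
          = (if u \<in> B then int (card (B - {u})) else 0)"
        using fin by (simp add: sum.If_cases Int_def)
    qed simp
    also have "\<dots> = (\<Sum>u\<in>B. int (card (B - {u})))"
      using fin that by (simp add: sum.If_cases Int_absorb1)
    also have "\<dots> = int (card B) * (int (card B) - 1)"
      by (rule sum_card_remove1[OF fB])
    finally show ?thesis by simp
  qed
  have "(\<Sum>y\<in>verts G. int (card (nbrs y \<inter> A)) * (int (card (nbrs y \<inter> A)) - 1))
      = (\<Sum>y\<in>verts G. \<Sum>u\<in>A. \<Sum>w\<in>A - {u}. if y \<in> nbrs u \<and> y \<in> nbrs w then 1 else 0)"
    by (intro sum.cong refl, subst *) (auto intro!: sum.cong split: if_splits dest: nbrs_sym[THEN iffD1])
  also have "\<dots> = (\<Sum>u\<in>A. \<Sum>w\<in>A - {u}. codeg u w)"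
    unfolding codeg_eq_sum by (rule trans[OF sum.swap], rule sum.cong[OF refl], rule sum.swap)
  finally show ?thesis .
qed

text \<open>\<open>quads_ge_excess\<close> is summed over all vertices: the total excess is the
  number of ordered two-edge paths minus the number of ordered pairs of distinct vertices.\<close>

lemma sum_quads_ge_deg:
  "2 * (\<Sum>v\<in>verts G. deg v * (deg v - 1)) - 2 * int (card (verts G)) * (int (card (verts G)) - 1)
    \<le> (\<Sum>v\<in>verts G. quads v)"
proof -
  have "2 * (\<Sum>v\<in>verts G. deg v * (deg v - 1)) - 2 * int (card (verts G)) * (int (card (verts G)) - 1)
      = 2 * (\<Sum>v\<in>verts G. codeg_excess v)"
    using sum_sum_nbrs[of deg]
    by (simp add: codeg_excess_eq sum_subtractf right_diff_distrib mult.assoc cong: sum.cong)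
  also have "\<dots> \<le> (\<Sum>v\<in>verts G. quads v)"
    unfolding sum_distrib_left by (intro sum_mono quads_ge_excess)
  finally show ?thesis .
qed

text \<open>Double counting of the pairs of vertices outside the neighbourhood of \<open>x\<close> by their common
  neighbours.\<close>

lemma sum_quads_ge_outside:
  assumes x: "x \<in> verts G"
  defines "n \<equiv> int (card (verts G))"
  shows "2 * ((n - 1) * q * (q - 1)
      + 2 * (q - 1) * ((\<Sum>v\<in>verts G. deg v) - deg x - (n - 1) - codeg_excess x - q * (n - 1)))
    \<le> 2 * (n - deg x) * (n - deg x - 1) + (\<Sum>v\<in>verts G. quads v)"
proof -
  define W where "W = verts G - nbrs x"
  define k where "k y = int (card (nbrs y \<inter> W))" for y
  have W: "W \<subseteq> verts G" "finite W" using finite_verts by (auto simp: W_def)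
  have cW: "int (card W) = n - deg x"
    using nbrs_subset[of x] finite_verts
    by (simp add: W_def n_def deg_def card_Diff_subset card_mono of_nat_diff)
  have n1: "card (verts G) \<ge> 1"
    using x finite_verts by (auto simp: Suc_le_eq card_gt_0_iff)
  have k_eq: "k y = deg y - codeg x y" for y
  proof -
    have "nbrs y \<inter> W = nbrs y - (nbrs x \<inter> nbrs y)" using nbrs_subset by (auto simp: W_def)
    then show ?thesis
      by (simp add: k_def deg_def codeg_def card_Diff_subset card_mono of_nat_diff)
  qed
  have kx: "k x = 0" by (simp add: k_eq codeg_self)
  have *: "2 * codeg u w \<le> 2 + codeg u w * (codeg u w - 1)" for u w
    using twice_pred_le[of "codeg u w"] by (simp add: algebra_simps)
  have "2 * (\<Sum>y\<in>verts G. k y * (k y - 1)) = (\<Sum>u\<in>W. \<Sum>w\<in>W - {u}. 2 * codeg u w)"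
    using sum_pairs_codeg[OF W(1)] by (simp add: k_def sum_distrib_left)
  also have "\<dots> \<le> (\<Sum>u\<in>W. \<Sum>w\<in>W - {u}. 2 + codeg u w * (codeg u w - 1))"
    by (intro sum_mono *)
  also have "\<dots> = 2 * (\<Sum>u\<in>W. int (card (W - {u})))
      + (\<Sum>u\<in>W. \<Sum>w\<in>W - {u}. codeg u w * (codeg u w - 1))"
    by (simp add: sum.distrib sum_distrib_left)
  also have "(\<Sum>u\<in>W. int (card (W - {u}))) = (n - deg x) * (n - deg x - 1)"
    by (simp only: sum_card_remove1[OF W(2)] cW)
  also have "(\<Sum>u\<in>W. \<Sum>w\<in>W - {u}. codeg u w * (codeg u w - 1)) \<le> (\<Sum>u\<in>W. quads u)"
    unfolding quads_def
    by (intro sum_mono sum_mono2) (use W finite_verts prod_pred_nonneg in auto)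
  also have "\<dots> \<le> (\<Sum>v\<in>verts G. quads v)"
    by (intro sum_mono2) (use W finite_verts quads_nonneg in auto)
  finally have le: "2 * (\<Sum>y\<in>verts G. k y * (k y - 1))
      \<le> 2 * ((n - deg x) * (n - deg x - 1)) + (\<Sum>v\<in>verts G. quads v)"
    by simp
  \<comment> \<open>A linear bound at \<open>q\<close>, in the application the typical
    \<open>k y\<close> (degree \<open>q + 1\<close>, codegree 1 with \<open>x\<close>); its slack is
    \<open>(k y - q) * (k y - q + 1)\<close>. The vertex \<open>x\<close> is left out, as
    \<open>k x = 0\<close> is far from \<open>q\<close>.\<close>
  have "(\<Sum>y\<in>verts G - {x}. q * (q - 1) + 2 * (q - 1) * (k y - q))
      \<le> (\<Sum>y\<in>verts G - {x}. k y * (k y - 1))"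
  proof (rule sum_mono)
    fix y
    show "q * (q - 1) + 2 * (q - 1) * (k y - q) \<le> k y * (k y - 1)"
      using prod_pred_nonneg[of "k y - q + 1"] by (simp add: algebra_simps)
  qed
  also have "\<dots> = (\<Sum>y\<in>verts G. k y * (k y - 1))"
    using x finite_verts kx by (simp add: sum_diff1)
  finally have ge: "(n - 1) * q * (q - 1) + 2 * (q - 1) * ((\<Sum>y\<in>verts G - {x}. k y) - (n - 1) * q)
      \<le> (\<Sum>y\<in>verts G. k y * (k y - 1))"
    using n1 x finite_verts
    by (simp add: sum.distrib sum_subtractf n_def of_nat_diff mult.assoc flip: sum_distrib_left)
  have k_sum: "(\<Sum>y\<in>verts G - {x}. k y)
      = (\<Sum>v\<in>verts G. deg v) - deg x - (n - 1) - codeg_excess x"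
    using n1 x finite_verts
    by (simp add: k_eq codeg_excess_def sum_subtractf sum_diff1 n_def of_nat_diff)
  show ?thesis
    using le ge unfolding k_sum by (simp add: algebra_simps)
qed

section \<open>Parity inside a neighbourhood\<close>

text \<open>For a neighbour \<open>x\<close> of \<open>v\<close>, \<open>codeg v x\<close> is the
  degree of \<open>x\<close> in the graph induced on \<open>nbrs v\<close>.\<close>

lemma even_sum_codeg_nbrs: "even (\<Sum>x\<in>nbrs v. codeg v x)"
proof -
  define H where "H = (nbrs v, {e \<in> edges G. e \<subseteq> nbrs v})"
  have "simple_graph H" "finite (verts H)"
    using simple by (auto simp: H_def simple_graph_def)
  from handshake[OF this]
  have "(\<Sum>x\<in>nbrs v. card {u. {u, x} \<in> edges H}) = 2 * card (edges H)"
    by (simp add: H_def)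
  moreover have "codeg v x = int (card {u. {u, x} \<in> edges H})" if "x \<in> nbrs v" for x
  proof -
    have "{u. {u, x} \<in> edges H} = nbrs v \<inter> nbrs x"
      using that by (auto simp: H_def nbrs_def)
    then show ?thesis by (simp add: codeg_def)
  qed
  ultimately have "(\<Sum>x\<in>nbrs v. codeg v x) = 2 * int (card (edges H))"
    by (simp flip: of_nat_sum)
  then show ?thesis by simp
qed

text \<open>Otherwise all codegrees with \<open>v\<close> are 1, so the neighbourhood of \<open>v\<close> has a perfect matching.\<close>

lemma quads_ge_2:
  assumes "v \<in> verts G" "odd (deg v)" "codeg_excess v \<ge> 0"
  shows "quads v \<ge> 2"
proof (rule ccontr)
  assume less: "\<not> quads v \<ge> 2"
  \<comment> \<open>Each summand is a product of consecutive integers, so a value below 2 must be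
    0.\<close>
  have ev: "even (quads v)"
    unfolding quads_def by (intro dvd_sum) auto
  have "quads v = 0"
  proof -
    have "quads v = 0 \<or> quads v = 1" using less quads_nonneg[of v] by linarith
    then show ?thesis using ev by auto
  qed
  then have "\<forall>x\<in>verts G - {v}. codeg v x * (codeg v x - 1) = 0"
    unfolding quads_def
    by (subst (asm) sum_nonneg_eq_0_iff) (use finite_verts prod_pred_nonneg in auto)
  then have le: "codeg v x \<le> 1" if "x \<in> verts G - {v}" for x
    using that by (metis diff_eq_eq add_0 mult_eq_0_iff order_refl zero_le_one)
  \<comment> \<open>Codegrees at most 1 with nonnegative total excess must all equal 1.\<close>
  have "(\<Sum>x\<in>verts G - {v}. 1 - codeg v x) = 0"
  proof (rule antisym)
    show "(\<Sum>x\<in>verts G - {v}. 1 - codeg v x) \<le> 0"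
      using assms(3) by (simp add: codeg_excess_def sum_subtractf)
    show "0 \<le> (\<Sum>x\<in>verts G - {v}. 1 - codeg v x)"
      by (intro sum_nonneg) (use le in auto)
  qed
  then have "\<forall>x\<in>verts G - {v}. 1 - codeg v x = 0"
    by (subst (asm) sum_nonneg_eq_0_iff) (use finite_verts le in auto)
  then have "codeg v x = 1" if "x \<in> nbrs v" for x
    using that nbrs_subset[of v] not_nbrs_self[of v] by fastforce
  then have "(\<Sum>x\<in>nbrs v. codeg v x) = deg v"
    by (simp add: deg_def)
  with even_sum_codeg_nbrs[of v] assms(2) show False by simp
qed

section \<open>From \<open>quads\<close> to copies of the 4-cycle\<close>

text \<open>The left side counts quadruples of two distinct vertices and two distinct common
  neighbours. Each yields a 4-cycle, and a given 4-cycle arises from at most eight of them.\<close>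

lemma sum_quads_le_copies:
  "(\<Sum>v\<in>verts G. quads v) \<le> 8 * int (card (copies (cycle_graph 4) G))"
proof -
  define Q where "Q = (SIGMA v:verts G. SIGMA x:verts G - {v}.
    SIGMA a:nbrs v \<inter> nbrs x. nbrs v \<inter> nbrs x - {a})"
  define F :: "'a \<times> 'a \<times> 'a \<times> 'a \<Rightarrow> 'a graph"
    where "F = (\<lambda>(v, x, a, b). four_cycle v a x b)"
  define C where "C = copies (cycle_graph 4) G"
  have "finite (edges G)"
    using simple finite_verts
    by (intro finite_subset[of "edges G" "Pow (verts G)"]) (auto simp: simple_graph_def)
  then have finC: "finite C"
    using finite_verts
    by (intro finite_subset[of C "Pow (verts G) \<times> Pow (edges G)"]) (auto simp: C_def copies_def subgraph_def)
  have Q_distinct: "distinct [v, a, x, b]" if "(v, x, a, b) \<in> Q" for v x a b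
    using that not_nbrs_self by (auto simp: Q_def)
  have card_Q: "int (card Q) = (\<Sum>v\<in>verts G. quads v)"
  proof -
    have "int (card (SIGMA a:nbrs v \<inter> nbrs x. nbrs v \<inter> nbrs x - {a})) = codeg v x * (codeg v x - 1)" for v x
      using sum_card_remove1[of "nbrs v \<inter> nbrs x"] by (simp add: card_SigmaI codeg_def del: card_Diff_insert)
    then show ?thesis
      using finite_verts by (simp add: Q_def quads_def card_SigmaI)
  qed
  have "Q \<subseteq> (\<Union>K\<in>C. {p \<in> Q. F p = K})"
  proof safe
    fix v x a b assume p: "(v, x, a, b) \<in> Q"
    note dist = Q_distinct[OF p]
    have "{v, a} \<in> edges G" "{a, x} \<in> edges G" "{x, b} \<in> edges G" "{b, v} \<in> edges G"
      using p by (auto simp: Q_def nbrs_def insert_commute)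
    moreover have "{v, a, x, b} \<subseteq> verts G"
      using p nbrs_subset by (auto simp: Q_def)
    ultimately have "subgraph (four_cycle v a x b) G"
      using dist by (auto simp: subgraph_def simple_graph_def four_cycle_def)
    then have "F (v, x, a, b) \<in> C"
      using four_cycle_iso[OF dist] by (simp add: F_def C_def copies_def)
    with p show "(v, x, a, b) \<in> (\<Union>K\<in>C. {p \<in> Q. F p = K})" by auto
  qed
  then have "card Q \<le> card (\<Union>K\<in>C. {p \<in> Q. F p = K})"
    by (rule card_mono[rotated])
      (use finite_verts finC in \<open>auto simp: Q_def intro!: finite_SigmaI\<close>)
  also have "\<dots> \<le> (\<Sum>K\<in>C. card {p \<in> Q. F p = K})"
    using finC by (rule card_UN_le)
  also have "\<dots> \<le> (\<Sum>K\<in>C. 8)"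
  proof (rule sum_mono)
    fix K
    show "card {p \<in> Q. F p = K} \<le> 8"
    proof (cases "{p \<in> Q. F p = K} = {}")
      case True
      then show ?thesis by (metis card.empty zero_le)
    next
      case False
      then obtain v x a b where p: "(v, x, a, b) \<in> Q" "F (v, x, a, b) = K" by auto
      let ?L = "[(v, x, a, b), (v, x, b, a), (x, v, a, b), (x, v, b, a),
        (a, b, v, x), (a, b, x, v), (b, a, v, x), (b, a, x, v)]"
      have "{p \<in> Q. F p = K} \<subseteq> set ?L"
      proof
        fix p' assume p': "p' \<in> {p \<in> Q. F p = K}"
        obtain v' x' a' b' where eq: "p' = (v', x', a', b')" by (cases p')
        show "p' \<in> set ?L"
          unfolding eq
          by (rule four_cycle_eq_cases[OF Q_distinct Q_distinct])
            (use p p' in \<open>auto simp: eq F_def\<close>)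
      qed
      then have "card {p \<in> Q. F p = K} \<le> card (set ?L)"
        by (intro card_mono) auto
      also have "\<dots> \<le> 8"
        using card_length[of ?L] by simp
      finally show ?thesis .
    qed
  qed
  finally show ?thesis
    using card_Q by (simp add: C_def)
qed

end

section \<open>Integer arithmetic for a vertex of large degree\<close>

text \<open>The numerical core of the estimate for one vertex of degree \<open>q + 1 + a\<close> with codegree
  excess \<open>r\<close>; \<open>T\<close> is eight times the number of 4-cycles.\<close>

lemma excess_bound_arith:
  fixes q t a r T :: int
  assumes "q \<ge> 2" "t \<ge> 0" "a \<ge> 1"
    and T_upper: "T < 4 * t * q - 10 * q - 4 * t"
    and T_lower: "4 * q * (2 * t - q - 1) + 2 * (a * (a + 1)) \<le> T"
    and outside: "2 * ((q\<^sup>2 + q) * q * (q - 1)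
        + 2 * (q - 1) * (q * (q + 1)\<^sup>2 + 2 * t - (q + 1 + a) - (q\<^sup>2 + q) - r - q * (q\<^sup>2 + q)))
      \<le> 2 * (q\<^sup>2 - a) * (q\<^sup>2 - a - 1) + T"
  shows "(t + 1) * a \<le> r"
proof (rule ccontr)
  assume "\<not> (t + 1) * a \<le> r"
  then have r: "(q - 1) * r \<le> (q - 1) * ((t + 1) * a)"
    using \<open>q \<ge> 2\<close> by (intro mult_left_mono) auto
  \<comment> \<open>After \<open>r\<close> is replaced by its bound \<open>(t + 1) * a\<close>,
    \<open>K\<close> is the coefficient of \<open>4 * a\<close> in \<open>outside'\<close>.\<close>
  define K where "K = q\<^sup>2 - 2 * q + 2 - t * (q - 1)"
  have outside': "4 * (2 * t * (q - 1) - (q\<^sup>2 - 1) + a * (q\<^sup>2 - q + 1) - (q - 1) * r)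
      \<le> 2 * (a * (a + 1)) + T"
    using outside by (simp add: algebra_simps power2_eq_square)
  have aK: "4 * (a * K) < 4 * (q\<^sup>2 - 1) - 10 * q - 4 * t * (q - 1) + 2 * (a * (a + 1))"
    using outside' r T_upper by (simp add: K_def algebra_simps)
  \<comment> \<open>The two bounds on \<open>T\<close> limit \<open>a\<close> and \<open>t\<close>
    at once. With \<open>a * (a + 1) \<ge> 2\<close> they force \<open>t + 3 \<le> q\<close>, which
    makes \<open>K\<close> positive.\<close>
  have quad: "2 * (a * (a + 1)) < 4 * q\<^sup>2 - 6 * q - 4 * t * q - 4 * t"
    using T_lower T_upper by (simp add: algebra_simps power2_eq_square)
  have "2 \<le> a * (a + 1)"
    using mult_mono[of 1 a 2 "a + 1"] \<open>a \<ge> 1\<close> by simp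
  then have "(t + 3) * (q + 1) < (q + 1) * (q + 1)"
    using quad \<open>q \<ge> 2\<close> by (simp add: algebra_simps power2_eq_square)
  then have "t + 3 \<le> q"
    using \<open>q \<ge> 2\<close> by simp
  have "t * (q - 1) \<le> (q - 3) * (q - 1)"
    using \<open>t + 3 \<le> q\<close> \<open>q \<ge> 2\<close> by (intro mult_right_mono) auto
  then have K_pos: "K > 0"
    using \<open>q \<ge> 2\<close> by (simp add: K_def algebra_simps power2_eq_square)
  show False
  \<comment> \<open>For \<open>a = 1\<close> the term \<open>2 * (a * (a + 1))\<close> is exactly 4
    and the terms in \<open>t\<close> cancel in \<open>aK\<close>. For \<open>a \<ge> 2\<close> the
    left side is at least \<open>8 * K\<close>, so the cruder estimate \<open>quad\<close> of this
    term suffices.\<close>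
  proof (cases "a = 1")
    case True
    then show False
      using aK \<open>q \<ge> 2\<close> by (simp add: K_def algebra_simps)
  next
    case False
    then have "2 * K \<le> a * K"
      using \<open>a \<ge> 1\<close> K_pos by (intro mult_right_mono) auto
    then show False
      using aK quad \<open>t \<ge> 0\<close> \<open>q \<ge> 2\<close> by (simp add: K_def algebra_simps)
  qed
qed

section \<open>Combination of the estimates\<close>

context finite_graph
begin

lemma sum_quads_bound:
  fixes q t :: int
  assumes q: "q \<ge> 2" "even q" and t: "t \<ge> 0"
    and n: "int (card (verts G)) = q\<^sup>2 + q + 1"
    and e: "2 * int (card (edges G)) = q * (q + 1)\<^sup>2 + 2 * t"
  shows "4 * t * q - 10 * q - 4 * t \<le> (\<Sum>v\<in>verts G. quads v)"
proof (rule ccontr)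
  define T where "T = (\<Sum>v\<in>verts G. quads v)"
  define a where "a v = deg v - (q + 1)" for v
  \<comment> \<open>With \<open>p\<close> and \<open>b\<close> as the positive and negative parts of
    \<open>a\<close>, the difference \<open>P - B\<close> is fixed by the number of edges.\<close>
  define p where "p v = max 0 (a v)" for v
  define b where "b v = max 0 (- a v)" for v
  define P where "P = (\<Sum>v\<in>verts G. p v)"
  define B where "B = (\<Sum>v\<in>verts G. b v)"
  assume "\<not> 4 * t * q - 10 * q - 4 * t \<le> (\<Sum>v\<in>verts G. quads v)"
  then have T_upper: "T < 4 * t * q - 10 * q - 4 * t"
    by (simp add: T_def)
  have sum_d: "(\<Sum>v\<in>verts G. deg v) = q * (q + 1)\<^sup>2 + 2 * t"
    using sum_deg e by simp
  have sum_a: "(\<Sum>v\<in>verts G. a v) = 2 * t - q - 1"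
    using n by (simp add: a_def sum_subtractf sum_d algebra_simps power2_eq_square)
  have deg_a: "deg v * (deg v - 1) = q * (q + 1) + 2 * q * a v + a v * (a v + 1)" for v
    by (simp add: a_def algebra_simps)
  have T_lower: "4 * q * (2 * t - q - 1) + 2 * (\<Sum>v\<in>verts G. a v * (a v + 1)) \<le> T"
    using sum_quads_ge_deg
    by (simp add: T_def deg_a sum.distrib n sum_a flip: sum_distrib_left)
      (simp add: algebra_simps power2_eq_square)
  have a_nonneg: "0 \<le> a v * (a v + 1)" for v
    using prod_pred_nonneg[of "a v + 1"] by (simp add: mult.commute)
  have excess_ge: "(t + 1) * a x \<le> codeg_excess x" if x: "x \<in> verts G" "a x \<ge> 1" for x
  proof (rule excess_bound_arith[OF q(1) t x(2) T_upper])
    \<comment> \<open>All these terms are nonnegative, so the one of \<open>x\<close> alone may be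
      kept in \<open>T_lower\<close>.\<close>
    have "a x * (a x + 1) \<le> (\<Sum>v\<in>verts G. a v * (a v + 1))"
      using x(1) finite_verts a_nonneg by (intro member_le_sum) auto
    then show "4 * q * (2 * t - q - 1) + 2 * (a x * (a x + 1)) \<le> T"
      using T_lower by linarith
    have d: "deg x = q + 1 + a x" by (simp add: a_def)
    have m: "q\<^sup>2 + q + 1 - (q + 1 + a x) = q\<^sup>2 - a x" "q\<^sup>2 + q + 1 - 1 = q\<^sup>2 + q" by auto
    show "2 * ((q\<^sup>2 + q) * q * (q - 1)
        + 2 * (q - 1) * (q * (q + 1)\<^sup>2 + 2 * t - (q + 1 + a x) - (q\<^sup>2 + q) - codeg_excess x - q * (q\<^sup>2 + q)))
      \<le> 2 * (q\<^sup>2 - a x) * (q\<^sup>2 - a x - 1) + T"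
      using sum_quads_ge_outside[OF x(1), of q] unfolding n sum_d d m T_def .
  qed
  have "2 * (t + 1) * P \<le> T"
  proof -
    have "2 * ((t + 1) * p v) \<le> quads v" if "v \<in> verts G" for v
    proof (cases "a v \<ge> 1")
      case True
      then show ?thesis
        using quads_ge_excess[of v] excess_ge[OF that] by (simp add: p_def)
    next
      case False
      then have "p v = 0" by (simp add: p_def)
      then show ?thesis using quads_nonneg by simp
    qed
    then have "(\<Sum>v\<in>verts G. 2 * ((t + 1) * p v)) \<le> T"
      unfolding T_def by (intro sum_mono)
    then show ?thesis
      by (simp only: P_def sum_distrib_left mult.assoc)
  qed
  also have "T < 2 * (t + 1) * (2 * q)"
    using T_upper t q by (simp add: algebra_simps)
  finally have P_less: "P < 2 * q"
    using t by simp
  \<comment> \<open>Degrees all equal to \<open>q + 1\<close> would give excess 0, since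
    \<open>(q + 1) * q\<close> is the number of other vertices; only the deviations remain.\<close>
  have excess_eq: "codeg_excess v = q * a v + (\<Sum>w\<in>nbrs v. a w)" if "v \<in> verts G" for v
  proof -
    have "(\<Sum>w\<in>nbrs v. a w) = (\<Sum>w\<in>nbrs v. deg w) - deg v * (q + 1)"
      by (simp add: a_def sum_subtractf deg_def)
    then show ?thesis
      using codeg_excess_eq[OF that] by (simp add: n a_def algebra_simps power2_eq_square)
  qed
  \<comment> \<open>One inequality for all signs of \<open>a v\<close>. If positive, the excess
    bound suffices, as \<open>1 - p v \<le> 0\<close>. If negative, \<open>1 - b v \<le> 0\<close>
    makes the left side nonpositive. If zero, either some neighbour has \<open>b w \<ge> 1\<close>
    and cancels the 1, or parity supplies the 2.\<close>
  have quads_ge: "2 * (q * p v + 1 - p v - b v - (\<Sum>w\<in>nbrs v. b w)) \<le> quads v"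
    if v: "v \<in> verts G" for v
  proof -
    have b0: "0 \<le> (\<Sum>w\<in>nbrs v. b w)"
      by (intro sum_nonneg) (simp add: b_def)
    have ab: "- (\<Sum>w\<in>nbrs v. b w) \<le> (\<Sum>w\<in>nbrs v. a w)"
      unfolding sum_negf[symmetric] by (intro sum_mono) (simp add: b_def)
    consider "a v \<ge> 1" | "a v \<le> - 1" | "a v = 0" by linarith
    then show ?thesis
    proof cases
      case 1
      then show ?thesis
        using quads_ge_excess[of v] excess_eq[OF v] ab by (simp add: p_def b_def)
    next
      case 2
      then show ?thesis
        using quads_nonneg[of v] b0 by (simp add: p_def b_def)
    next
      case 3
      show ?thesis
      proof (cases "(\<Sum>w\<in>nbrs v. b w) = 0")
        case True
        have "odd (deg v)" using 3 q(2) by (simp add: a_def)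
        moreover have "codeg_excess v \<ge> 0" using excess_eq[OF v] ab True 3 by simp
        ultimately show ?thesis
          using quads_ge_2[OF v] 3 True by (simp add: p_def b_def)
      next
        case False
        then show ?thesis
          using b0 quads_nonneg[of v] 3 by (simp add: p_def b_def)
      qed
    qed
  qed
  \<comment> \<open>Only vertices of degree at most \<open>q\<close> have nonzero
    \<open>b w\<close>.\<close>
  have "(\<Sum>w\<in>verts G. deg w * b w) \<le> (\<Sum>w\<in>verts G. q * b w)"
  proof (rule sum_mono)
    fix w
    show "deg w * b w \<le> q * b w"
      by (cases "a w \<ge> 0") (auto simp: b_def a_def intro!: mult_right_mono)
  qed
  then have deg_b: "(\<Sum>v\<in>verts G. \<Sum>w\<in>nbrs v. b w) \<le> q * B"
    by (simp add: sum_sum_nbrs B_def sum_distrib_left)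
  have "(\<Sum>v\<in>verts G. 2 * (q * p v + 1 - p v - b v - (\<Sum>w\<in>nbrs v. b w))) \<le> T"
    unfolding T_def by (intro sum_mono quads_ge)
  then have "2 * (q * P + (q\<^sup>2 + q + 1) - P - B - (\<Sum>v\<in>verts G. \<Sum>w\<in>nbrs v. b w)) \<le> T"
    by (simp add: P_def B_def sum.distrib sum_subtractf n flip: sum_distrib_left)
  then have "2 * (q * P + (q\<^sup>2 + q + 1) - P - B - q * B) \<le> T"
    using deg_b by (simp add: algebra_simps)
  moreover have "B = P + q + 1 - 2 * t"
  proof -
    have "P - B = (\<Sum>v\<in>verts G. a v)"
      unfolding P_def B_def sum_subtractf[symmetric] by (intro sum.cong) (auto simp: p_def b_def)
    then show ?thesis using sum_a by linarith
  qed
  ultimately have "2 * (2 * t * (q + 1) - q - 2 * P) \<le> T"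
    by (simp add: algebra_simps power2_eq_square)
  \<comment> \<open>As \<open>P < 2 * q\<close>, the lower bound exceeds
    \<open>4 * t * q + 4 * t - 10 * q\<close>. This is the source of the coefficient 10, which
    becomes 5/2 in the theorem.\<close>
  then show False
    using T_upper P_less t by (simp add: algebra_simps)
qed

end

theorem theorem9p2:
  fixes G :: "'a graph" and q t :: nat
  assumes "q > 0" and "even q" and "t \<ge> 1"
    and "simple_graph G"
    and "card (verts G) = q\<^sup>2 + q + 1"
    and "real (card (edges G)) = 1 / 2 * real q * (real q + 1)\<^sup>2 + real t"
  shows "real (card (copies (cycle_graph 4) G)) \<ge> 1 / 2 * (real t * real q - 5 / 2 * real q - real t)"
proof -
  \<comment> \<open>An infinite set has \<open>card\<close> equal to 0, whereas the prescribed
    number of vertices is positive.\<close>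
  have "finite (verts G)"
    using assms(5) by (intro card_ge_0_finite) simp
  then interpret finite_graph G
    using assms(4) by unfold_locales
  have "q \<ge> 2" using assms(1,2) by (auto elim!: evenE)
  \<comment> \<open>Doubling clears the fraction, so that the edge count becomes an integer
    equation.\<close>
  have "real_of_int (2 * int (card (edges G))) = real_of_int (int q * (int q + 1)\<^sup>2 + 2 * int t)"
    using assms(6) by simp
  then have "2 * int (card (edges G)) = int q * (int q + 1)\<^sup>2 + 2 * int t"
    by (simp only: of_int_eq_iff)
  then have "4 * int t * int q - 10 * int q - 4 * int t \<le> (\<Sum>v\<in>verts G. quads v)"
    using \<open>q \<ge> 2\<close> assms(2,5) by (intro sum_quads_bound) auto
  also have "\<dots> \<le> 8 * int (card (copies (cycle_graph 4) G))"
    by (rule sum_quads_le_copies)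
  finally have "real_of_int (4 * int t * int q - 10 * int q - 4 * int t)
      \<le> real_of_int (8 * int (card (copies (cycle_graph 4) G)))"
    by (simp only: of_int_le_iff)
  then show ?thesis by simp
qed

end
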